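(* Let $\mathcal{M}$ be a von Neumann algebra with a faithful normal semifinite weight $\nu$. For each fixed $f\in X_{1+\infty}$, the $\widetilde{K}$-functional $t\mapsto\widetilde{K}(f,t)$ is a non-negative non-decreasing concave function of $t\ge0$, and hence may be written in the form $$\widetilde{K}(f,t)=\widetilde{K}(f,0+)+\int_0^t\widetilde{k}(f,s)\,ds\qquad(t>0),$$ where $\widetilde{k}(f,\cdot)$ is a uniquely defined non-negative, decreasing, right-continuous function of $s>0$.
   Context: $\mathcal{A}=\mathcal{M}\rtimes_{\sigma^\nu}\mathbb{R}$ is the crossed product by the modular group of $\nu$, $\mathcal{M}$ being identified with its canonical image $\pi(\mathcal{M})$ in $\mathcal{A}$; $(\theta_s)_{s\in\mathbb{R}}$ is the dual action; $\tau_{\mathcal{A}}$ is the canonical trace, with $\tau_{\mathcal{A}}\circ\theta_s=e^{-s}\tau_{\mathcal{A}}$; $\widetilde{\mathcal{A}}$ is the $*$-algebra of $\tau_{\mathcal{A}}$-measurable operators with the topology of convergence in measure, to which $\theta_s$ extends; $h=d\widetilde{\nu}/d\tau_{\mathcal{A}}$ is the density of the dual weight, a positive non-singular operator affiliated with $\mathcal{A}$, with $\theta_s(h)=e^{-s}h$. For $0<p<\infty$, $L^p(\mathcal{M})=\{x\in\widetilde{\mathcal{A}}:\theta_s(x)=e^{-s/p}x\ \forall s\in\mathbb{R}\}$ with its usual Haagerup norm $\|\cdot\|_p$, and $L^\infty(\mathcal{M})=\{x\in\widetilde{\mathcal{A}}:\theta_s(x)=x\ \forall s\in\mathbb{R}\}=\mathcal{M}$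 with norm $\|\cdot\|_\infty$. $\mathfrak{n}_\nu=\{a\in\mathcal{M}:\nu(a^*a)<\infty\}$. $[\cdot]$ around an operator denotes closure; products of measurable operators are strong products. $L^2(\mathcal{M};l)$ and $L^2(\mathcal{M};r)$ are the closures in $\widetilde{\mathcal{A}}$ of $\{[ah^{1/2}]:a\in\mathfrak{n}_\nu\}$ and $\{[h^{1/2}a^*]:a\in\mathfrak{n}_\nu\}$ respectively, with norm $\|\cdot\|_2$. Let $\varphi_{1\cap\infty}(t)=\max(1,t)$, $\varphi_{1+\infty}(t)=\min(1,t)$ and $\zeta_1(t)=\varphi_{1+\infty}(t)/t=\min(1,1/t)$ for $t>0$. Define $\iota_\infty(a)=\varphi_{1+\infty}(h)^{1/2}a\varphi_{1+\infty}(h)^{1/2}$ for $a\in L^\infty(\mathcal{M})$, $\iota_{2,r}(a)=\zeta_1(h)^{1/2}a\varphi_{1+\infty}(h)^{1/2}$ for $a\in L^2(\mathcal{M};r)$, $\iota_{2,l}(a)=\varphi_{1+\infty}(h)^{1/2}a\zeta_1(h)^{1/2}$ for $a\in L^2(\mathcal{M};l)$, $\iota_1(a)=\zeta_1(h)^{1/2}a\zeta_1(h)^{1/2}$ for $a\in L^1(\mathcal{M})$. Let $$S_{1+\infty}=\{a\in\widetilde{\mathcal{A}}:\theta_s(a\varphi_{1\cap\infty}(h)^{1/2}\chi_{[0,\delta]}(h))=e^{-s/2}a\varphi_{1\cap\infty}(h)^{1/2}\chi_{[0,e^s\delta]}(h)\text{ for all }\delta>0,\ s\in\mathbb{R}\}$$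 and $X_{1+\infty}=\mathrm{span}\{a^*b:a,b\in S_{1+\infty}\}\subset\widetilde{\mathcal{A}}$, which equals $\iota_1(L^1(\mathcal{M}))+\iota_{2,r}(L^2(\mathcal{M};r))+\iota_{2,l}(L^2(\mathcal{M};l))+\iota_\infty(L^\infty(\mathcal{M}))$. For $f\in X_{1+\infty}$ and $t>0$ (and by the same formula for $t=0$), $$\widetilde{K}(f,t)=\inf(\|f_1\|_1+\sqrt{t}\,\|f_{2,r}\|_2+\sqrt{t}\,\|f_{2,l}\|_2+t\|f_\infty\|_\infty),$$ the infimum being over all representations $f=\iota_1(f_1)+\iota_{2,r}(f_{2,r})+\iota_{2,l}(f_{2,l})+\iota_\infty(f_\infty)$ with $f_1\in L^1(\mathcal{M})$, $f_{2,r}\in L^2(\mathcal{M};r)$, $f_{2,l}\in L^2(\mathcal{M};l)$, $f_\infty\in L^\infty(\mathcal{M})$. "Decreasing" means non-increasing. *)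

theory Defs
  imports "HOL-Analysis.Analysis"
begin

section \<open>Complex Hilbert spaces\<close>

class complex_vector = real_vector +
  fixes scaleC :: "complex \<Rightarrow> 'a \<Rightarrow> 'a"  (infixr "*\<^sub>C" 75)
  assumes scaleC_add_right: "c *\<^sub>C (x + y) = c *\<^sub>C x + c *\<^sub>C y"
    and scaleC_add_left: "(c + d) *\<^sub>C x = c *\<^sub>C x + d *\<^sub>C x"
    and scaleC_scaleC: "c *\<^sub>C d *\<^sub>C x = (c * d) *\<^sub>C x"
    and scaleR_scaleC: "r *\<^sub>R x = complex_of_real r *\<^sub>C x"

text \<open>The inner product is linear in the second variable; its real part is the real inner
  product of the class \<^class>\<open>real_inner\<close>, which also provides the norm and the topology.\<close>

class hilbert_space = complex_vector + real_inner + complete_space +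
  fixes cinner :: "'a \<Rightarrow> 'a \<Rightarrow> complex"
  assumes cinner_commute: "cinner y x = cnj (cinner x y)"
    and cinner_add_right: "cinner x (y + z) = cinner x y + cinner x z"
    and cinner_scaleC_right: "cinner x (c *\<^sub>C y) = c * cinner x y"
    and Re_cinner: "Re (cinner x y) = inner x y"


section \<open>Bounded operators and von Neumann algebras\<close>

type_synonym 'h op = "'h \<Rightarrow> 'h"

definition bounded_op :: "'h::hilbert_space op \<Rightarrow> bool" where
  "bounded_op T \<longleftrightarrow> bounded_linear T \<and> (\<forall>c x. T (c *\<^sub>C x) = c *\<^sub>C T x)"

definition cadj :: "'h::hilbert_space op \<Rightarrow> 'h op" where
  "cadj T = (THE S. \<forall>x y. cinner (S x) y = cinner x (T y))"

definition commutant :: "'h::hilbert_space op set \<Rightarrow> 'h op set" where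
  "commutant N = {T. bounded_op T \<and> (\<forall>S\<in>N. S \<circ> T = T \<circ> S)}"

definition von_neumann_algebra :: "'h::hilbert_space op set \<Rightarrow> bool" where
  "von_neumann_algebra M \<longleftrightarrow>
     (\<forall>T\<in>M. bounded_op T \<and> cadj T \<in> M) \<and> commutant (commutant M) = M"

definition op_le :: "'h::hilbert_space op \<Rightarrow> 'h op \<Rightarrow> bool" where
  "op_le S T \<longleftrightarrow> (\<forall>x. cinner x (T x - S x) \<in> \<real>\<^sub>\<ge>\<^sub>0)"

definition pos_part :: "'h::hilbert_space op set \<Rightarrow> 'h op set" where
  "pos_part M = {T\<in>M. op_le (\<lambda>_. 0) T}"

definition projections :: "'h::hilbert_space op set \<Rightarrow> 'h op set" where
  "projections M = {p\<in>M. p \<circ> p = p \<and> cadj p = p}"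

definition compl_proj :: "'h::hilbert_space op \<Rightarrow> 'h op" where
  "compl_proj p = (\<lambda>x. x - p x)"

definition star_automorphism :: "'h::hilbert_space op set \<Rightarrow> ('h op \<Rightarrow> 'h op) \<Rightarrow> bool" where
  "star_automorphism M \<alpha> \<longleftrightarrow> bij_betw \<alpha> M M \<and>
     (\<forall>x\<in>M. \<forall>y\<in>M. \<alpha> (\<lambda>\<xi>. x \<xi> + y \<xi>) = (\<lambda>\<xi>. \<alpha> x \<xi> + \<alpha> y \<xi>) \<and> \<alpha> (x \<circ> y) = \<alpha> x \<circ> \<alpha> y) \<and>
     (\<forall>x\<in>M. (\<forall>c. \<alpha> (\<lambda>\<xi>. c *\<^sub>C x \<xi>) = (\<lambda>\<xi>. c *\<^sub>C \<alpha> x \<xi>)) \<and> \<alpha> (cadj x) = cadj (\<alpha> x))"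

text \<open>The \<open>\<sigma>\<close>-weakly continuous functionals are \<open>x \<mapsto> \<Sum>n. \<langle>\<xi>\<^sub>n, x \<eta>\<^sub>n\<rangle>\<close>
  with square-summable sequences \<open>\<xi>\<close>, \<open>\<eta>\<close>; the positive ones are those with \<open>\<xi> = \<eta>\<close>.\<close>

definition square_summable :: "(nat \<Rightarrow> 'h::hilbert_space) \<Rightarrow> bool" where
  "square_summable \<xi> \<longleftrightarrow> summable (\<lambda>n. (norm (\<xi> n))\<^sup>2)"

definition sigma_weakly_dense :: "'h::hilbert_space op set \<Rightarrow> 'h op set \<Rightarrow> bool" where
  "sigma_weakly_dense D M \<longleftrightarrow> (\<forall>x\<in>M. \<forall>F::((nat \<Rightarrow> 'h) \<times> (nat \<Rightarrow> 'h)) set. \<forall>\<epsilon>>0.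
     finite F \<and> (\<forall>(\<xi>, \<eta>)\<in>F. square_summable \<xi> \<and> square_summable \<eta>) \<longrightarrow>
     (\<exists>y\<in>D. \<forall>(\<xi>, \<eta>)\<in>F. cmod (\<Sum>n. cinner (\<xi> n) (x (\<eta> n) - y (\<eta> n))) < \<epsilon>))"

definition vector_functional :: "(nat \<Rightarrow> 'h::hilbert_space) \<Rightarrow> 'h op \<Rightarrow> ennreal" where
  "vector_functional \<xi> x = (\<Sum>n. ennreal (Re (cinner (\<xi> n) (x (\<xi> n)))))"


section \<open>Weights\<close>

text \<open>Only the values of a weight on \<^term>\<open>pos_part M\<close> are relevant.\<close>

definition weight :: "'h::hilbert_space op set \<Rightarrow> ('h op \<Rightarrow> ennreal) \<Rightarrow> bool" where
  "weight M \<nu> \<longleftrightarrow>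
     (\<forall>x\<in>pos_part M. \<forall>y\<in>pos_part M. \<nu> (\<lambda>\<xi>. x \<xi> + y \<xi>) = \<nu> x + \<nu> y) \<and>
     (\<forall>x\<in>pos_part M. \<forall>c\<ge>0. \<nu> (\<lambda>\<xi>. c *\<^sub>R x \<xi>) = ennreal c * \<nu> x)"

definition faithful_weight :: "'h::hilbert_space op set \<Rightarrow> ('h op \<Rightarrow> ennreal) \<Rightarrow> bool" where
  "faithful_weight M \<nu> \<longleftrightarrow> (\<forall>x\<in>pos_part M. \<nu> x = 0 \<longrightarrow> x = (\<lambda>_. 0))"

definition normal_weight :: "'h::hilbert_space op set \<Rightarrow> ('h op \<Rightarrow> ennreal) \<Rightarrow> bool" where
  "normal_weight M \<nu> \<longleftrightarrow> (\<forall>D x. D \<subseteq> pos_part M \<and> D \<noteq> {} \<and>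
     (\<forall>a\<in>D. \<forall>b\<in>D. \<exists>c\<in>D. op_le a c \<and> op_le b c) \<and>
     x \<in> pos_part M \<and> (\<forall>a\<in>D. op_le a x) \<and>
     (\<forall>y\<in>pos_part M. (\<forall>a\<in>D. op_le a y) \<longrightarrow> op_le x y) \<longrightarrow> \<nu> x = (SUP a\<in>D. \<nu> a))"

definition n_ideal :: "'h::hilbert_space op set \<Rightarrow> ('h op \<Rightarrow> ennreal) \<Rightarrow> 'h op set" where
  "n_ideal M \<nu> = {a\<in>M. \<nu> (cadj a \<circ> a) < \<infinity>}"

text \<open>\<open>finite_comb M \<nu> p q r s z\<close> says \<open>z = p - q + i (r - s)\<close> with positive \<open>p, q, r, s\<close> of
  finite weight. These \<open>z\<close> form the definition domain \<open>m\<^sub>\<nu>\<close> of the linear extension of \<open>\<nu>\<close>.\<close>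

definition finite_comb where
  "finite_comb M \<nu> p q r s z \<longleftrightarrow> {p, q, r, s} \<subseteq> {x\<in>pos_part M. (\<nu> x :: ennreal) < \<infinity>} \<and>
     z = (\<lambda>\<xi>. (p \<xi> - q \<xi>) + \<i> *\<^sub>C (r \<xi> - s \<xi>))"

definition m_ideal :: "'h::hilbert_space op set \<Rightarrow> ('h op \<Rightarrow> ennreal) \<Rightarrow> 'h op set" where
  "m_ideal M \<nu> = {z. \<exists>p q r s. finite_comb M \<nu> p q r s z}"

definition weight_ext :: "'h::hilbert_space op set \<Rightarrow> ('h op \<Rightarrow> ennreal) \<Rightarrow> 'h op \<Rightarrow> complex" where
  "weight_ext M \<nu> z = (THE c. \<exists>p q r s. finite_comb M \<nu> p q r s z \<and>
     c = Complex (enn2real (\<nu> p) - enn2real (\<nu> q)) (enn2real (\<nu> r) - enn2real (\<nu> s)))"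

definition semifinite_weight :: "'h::hilbert_space op set \<Rightarrow> ('h op \<Rightarrow> ennreal) \<Rightarrow> bool" where
  "semifinite_weight M \<nu> \<longleftrightarrow> sigma_weakly_dense (m_ideal M \<nu>) M"

definition fns_weight :: "'h::hilbert_space op set \<Rightarrow> ('h op \<Rightarrow> ennreal) \<Rightarrow> bool" where
  "fns_weight M \<nu> \<longleftrightarrow>
     weight M \<nu> \<and> faithful_weight M \<nu> \<and> normal_weight M \<nu> \<and> semifinite_weight M \<nu>"

text \<open>The modular group is the unique continuous one-parameter group of automorphisms satisfying
  the modular (KMS) condition for \<open>\<nu>\<close>, with the sign convention
  \<open>\<sigma>\<^sub>t(x) = \<Delta>\<^sup>i\<^sup>t x \<Delta>\<^sup>-\<^sup>i\<^sup>t\<close>.\<close>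

definition modular_group ::
  "'h::hilbert_space op set \<Rightarrow> ('h op \<Rightarrow> ennreal) \<Rightarrow> (real \<Rightarrow> 'h op \<Rightarrow> 'h op) \<Rightarrow> bool" where
  "modular_group M \<nu> \<sigma> \<longleftrightarrow>
     (\<forall>t. star_automorphism M (\<sigma> t)) \<and>
     (\<forall>s t. \<forall>x\<in>M. \<sigma> (s + t) x = \<sigma> s (\<sigma> t x)) \<and>
     (\<forall>x\<in>M. \<forall>\<xi>. continuous_on UNIV (\<lambda>t. \<sigma> t x \<xi>)) \<and>
     (\<forall>t. \<forall>x\<in>pos_part M. \<nu> (\<sigma> t x) = \<nu> x) \<and>
     (\<forall>x y. {x, cadj x, y, cadj y} \<subseteq> n_ideal M \<nu> \<longrightarrow>
        (\<exists>F. continuous_on {z. 0 \<le> Im z \<and> Im z \<le> 1} F \<and> bounded (F ` {z. 0 \<le> Im z \<and> Im z \<le> 1}) \<and>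
             F holomorphic_on {z. 0 < Im z \<and> Im z < 1} \<and>
             (\<forall>t. F (complex_of_real t) = weight_ext M \<nu> (\<sigma> t x \<circ> y) \<and>
                  F (complex_of_real t + \<i>) = weight_ext M \<nu> (y \<circ> \<sigma> t x))))"


section \<open>Unbounded operators\<close>

text \<open>Operators that need not be bounded are given by their graphs. Hence
  \<^term>\<open>b O a\<close> is the graph of the product \<open>a b\<close> (first \<open>b\<close>, then \<open>a\<close>).\<close>

type_synonym 'k graph = "('k \<times> 'k) set"

definition graph_of :: "'k op \<Rightarrow> 'k graph" where
  "graph_of T = {(x, T x) |x. True}"

definition fun_of :: "'k graph \<Rightarrow> 'k op" where
  "fun_of G = (\<lambda>x. THE y. (x, y) \<in> G)"

definition closed_operator :: "'k::hilbert_space graph \<Rightarrow> bool" where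
  "closed_operator G \<longleftrightarrow> closed G \<and> single_valued G \<and> (0, 0) \<in> G \<and>
     (\<forall>x y x' y'. (x, y) \<in> G \<and> (x', y') \<in> G \<longrightarrow> (x + x', y + y') \<in> G) \<and>
     (\<forall>c x y. (x, y) \<in> G \<longrightarrow> (c *\<^sub>C x, c *\<^sub>C y) \<in> G)"

definition densely_defined :: "'k::hilbert_space graph \<Rightarrow> bool" where
  "densely_defined G \<longleftrightarrow> closure (Domain G) = UNIV"

definition gadj :: "'k::hilbert_space graph \<Rightarrow> 'k graph" where
  "gadj G = {(x, y). \<forall>(u, v)\<in>G. cinner y u = cinner x v}"

definition positive_selfadjoint :: "'k::hilbert_space graph \<Rightarrow> bool" where
  "positive_selfadjoint G \<longleftrightarrow> closed_operator G \<and> densely_defined G \<and> gadj G = G \<and>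
     (\<forall>(x, y)\<in>G. cinner x y \<in> \<real>\<^sub>\<ge>\<^sub>0)"

definition nonsingular :: "'k::hilbert_space graph \<Rightarrow> bool" where
  "nonsingular G \<longleftrightarrow> (\<forall>x. (x, 0) \<in> G \<longrightarrow> x = 0)"

definition affiliated :: "'k::hilbert_space op set \<Rightarrow> 'k graph \<Rightarrow> bool" where
  "affiliated A G \<longleftrightarrow> (\<forall>T\<in>commutant A. \<forall>(x, y)\<in>G. (T x, T y) \<in> G)"


subsection \<open>Borel functional calculus\<close>

definition spec_dist :: "(real set \<Rightarrow> 'k::hilbert_space op) \<Rightarrow> 'k \<Rightarrow> real measure" where
  "spec_dist E \<xi> = measure_of UNIV (sets borel) (\<lambda>B. ennreal ((norm (E B \<xi>))\<^sup>2))"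

definition projection_valued_measure :: "(real set \<Rightarrow> 'k::hilbert_space op) \<Rightarrow> bool" where
  "projection_valued_measure E \<longleftrightarrow>
     (\<forall>B\<in>sets borel. bounded_op (E B) \<and> E B \<circ> E B = E B \<and> cadj (E B) = E B) \<and>
     E UNIV = id \<and>
     (\<forall>B\<in>sets borel. \<forall>C\<in>sets borel. E (B \<inter> C) = E B \<circ> E C) \<and>
     (\<forall>B. range B \<subseteq> sets borel \<and> disjoint_family B \<longrightarrow>
        (\<forall>\<xi>. (\<lambda>n::nat. E (B n) \<xi>) sums E (\<Union>n. B n) \<xi>))"

text \<open>The operator \<open>\<integral> f dE\<close> with its natural domain \<open>{\<xi>. \<integral> |f|\<^sup>2 d\<langle>\<xi>, E \<xi>\<rangle> < \<infinity>}\<close>.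
  The sesquilinear form \<open>\<langle>\<eta>, (\<integral> f dE) \<xi>\<rangle>\<close> is obtained by polarization from the
  scalar measures \<^term>\<open>spec_dist E\<close>.\<close>

definition spec_domain :: "(real set \<Rightarrow> 'k::hilbert_space op) \<Rightarrow> (real \<Rightarrow> complex) \<Rightarrow> 'k set" where
  "spec_domain E f = {\<xi>. (\<integral>\<^sup>+ t. ennreal ((cmod (f t))\<^sup>2) \<partial>spec_dist E \<xi>) < \<infinity>}"

definition spectral_integral ::
  "(real set \<Rightarrow> 'k::hilbert_space op) \<Rightarrow> (real \<Rightarrow> complex) \<Rightarrow> 'k graph" where
  "spectral_integral E f = {(\<xi>, \<zeta>). \<xi> \<in> spec_domain E f \<and>
     (\<forall>\<eta>\<in>spec_domain E f. cinner \<eta> \<zeta> =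
        (\<Sum>k<4. \<i> ^ k * (\<integral> t. f t \<partial>spec_dist E (\<xi> + \<i> ^ k *\<^sub>C \<eta>))) / 4)}"

text \<open>Off the Borel sets the spectral measure is put to zero to make it unique.\<close>

definition spectral_measure :: "'k::hilbert_space graph \<Rightarrow> real set \<Rightarrow> 'k op" where
  "spectral_measure G = (THE E. projection_valued_measure E \<and>
     spectral_integral E complex_of_real = G \<and> (\<forall>B. B \<notin> sets borel \<longrightarrow> E B = (\<lambda>_. 0)))"

definition fcalcC :: "(real \<Rightarrow> complex) \<Rightarrow> 'k::hilbert_space graph \<Rightarrow> 'k graph" where
  "fcalcC f G = spectral_integral (spectral_measure G) f"

definition fcalc :: "(real \<Rightarrow> real) \<Rightarrow> 'k::hilbert_space graph \<Rightarrow> 'k graph" where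
  "fcalc f = fcalcC (\<lambda>t. complex_of_real (f t))"

definition gabs :: "'k::hilbert_space graph \<Rightarrow> 'k graph" where
  "gabs G = fcalc sqrt (G O gadj G)"


subsection \<open>Strong operations\<close>

definition sprod :: "'k::hilbert_space graph \<Rightarrow> 'k graph \<Rightarrow> 'k graph"  (infixl "\<odot>" 70) where
  "a \<odot> b = closure (b O a)"

definition ssum :: "'k::hilbert_space graph \<Rightarrow> 'k graph \<Rightarrow> 'k graph"  (infixl "\<oplus>" 65) where
  "a \<oplus> b = closure {(x, y + z) |x y z. (x, y) \<in> a \<and> (x, z) \<in> b}"

definition sscale :: "complex \<Rightarrow> 'k::hilbert_space graph \<Rightarrow> 'k graph" where
  "sscale c a = closure {(x, c *\<^sub>C y) |x y. (x, y) \<in> a}"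

inductive_set strong_span :: "'k::hilbert_space graph set \<Rightarrow> 'k graph set"
  for S :: "'k graph set" where
  zero: "graph_of (\<lambda>_. 0) \<in> strong_span S"
| step: "\<lbrakk>x \<in> S; y \<in> strong_span S\<rbrakk> \<Longrightarrow> sscale c x \<oplus> y \<in> strong_span S"


section \<open>The crossed product by the modular group\<close>

text \<open>The data: a von Neumann algebra \<open>vna\<close> on \<open>'h\<close>, the weight \<open>wt\<close> on it, its modular group
  \<open>modgrp\<close>, the canonical map \<open>emb\<close> of \<open>C\<^sub>c(\<real>, 'h)\<close> into a Hilbert space \<open>'k\<close> which realises
  \<open>L\<^sup>2(\<real>, 'h)\<close> as the completion of \<open>C\<^sub>c(\<real>, 'h)\<close>, the trace \<open>trc\<close> on the crossed product, and
  the density \<open>dens\<close> of the dual weight.\<close>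

record ('h, 'k) haagerup_data =
  vna :: "'h op set"
  wt :: "'h op \<Rightarrow> ennreal"
  modgrp :: "real \<Rightarrow> 'h op \<Rightarrow> 'h op"
  emb :: "(real \<Rightarrow> 'h) \<Rightarrow> 'k"
  trc :: "'k op \<Rightarrow> ennreal"
  dens :: "'k graph"

definition Cc :: "(real \<Rightarrow> 'h::hilbert_space) set" where
  "Cc = {F. continuous_on UNIV F \<and> (\<exists>R. \<forall>t. \<bar>t\<bar> > R \<longrightarrow> F t = 0)}"

definition L2_completion :: "((real \<Rightarrow> 'h::hilbert_space) \<Rightarrow> 'k::hilbert_space) \<Rightarrow> bool" where
  "L2_completion J \<longleftrightarrow>
     (\<forall>F\<in>Cc. \<forall>G\<in>Cc. J (\<lambda>t. F t + G t) = J F + J G \<and>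
        cinner (J F) (J G) = integral UNIV (\<lambda>t. cinner (F t) (G t))) \<and>
     (\<forall>F\<in>Cc. \<forall>c. J (\<lambda>t. c *\<^sub>C F t) = c *\<^sub>C J F) \<and>
     closure (J ` Cc) = UNIV"

text \<open>The bounded operator on \<open>L\<^sup>2(\<real>, 'h)\<close> that acts by \<open>\<Phi>\<close> on \<open>C\<^sub>c(\<real>, 'h)\<close>.\<close>

definition L2_op :: "('h::hilbert_space, 'k::hilbert_space) haagerup_data \<Rightarrow>
    ((real \<Rightarrow> 'h) \<Rightarrow> (real \<Rightarrow> 'h)) \<Rightarrow> 'k op" where
  "L2_op D \<Phi> = (THE P. bounded_op P \<and> (\<forall>F\<in>Cc. P (emb D F) = emb D (\<Phi> F)))"

definition pi_rep :: "('h::hilbert_space, 'k::hilbert_space) haagerup_data \<Rightarrow> 'h op \<Rightarrow> 'k op" where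
  "pi_rep D x = L2_op D (\<lambda>F t. modgrp D (- t) x (F t))"

definition lambda_rep :: "('h::hilbert_space, 'k::hilbert_space) haagerup_data \<Rightarrow> real \<Rightarrow> 'k op" where
  "lambda_rep D s = L2_op D (\<lambda>F t. F (t - s))"

definition crossed_product :: "('h::hilbert_space, 'k::hilbert_space) haagerup_data \<Rightarrow> 'k op set" where
  "crossed_product D = commutant (commutant (pi_rep D ` vna D \<union> range (lambda_rep D)))"

text \<open>The dual action is implemented by the unitaries \<open>W\<^sub>s F(t) = e\<^sup>-\<^sup>i\<^sup>s\<^sup>t F(t)\<close>;
  on unbounded operators it is given by the same unitaries.\<close>

definition W_dual :: "('h::hilbert_space, 'k::hilbert_space) haagerup_data \<Rightarrow> real \<Rightarrow> 'k op" where
  "W_dual D s = L2_op D (\<lambda>F t. cis (- (s * t)) *\<^sub>C F t)"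

definition theta_bdd ::
  "('h::hilbert_space, 'k::hilbert_space) haagerup_data \<Rightarrow> real \<Rightarrow> 'k op \<Rightarrow> 'k op" where
  "theta_bdd D s x = W_dual D s \<circ> x \<circ> W_dual D (- s)"

definition theta ::
  "('h::hilbert_space, 'k::hilbert_space) haagerup_data \<Rightarrow> real \<Rightarrow> 'k graph \<Rightarrow> 'k graph" where
  "theta D s a = {(W_dual D s x, W_dual D s y) |x y. (x, y) \<in> a}"

text \<open>The dual weight \<open>\<phi> \<circ> T\<close>, where \<open>T(x) = \<integral> \<theta>\<^sub>s(x) ds\<close> lies in the extended positive part
  of \<open>\<pi>(M)\<close>. The normal weight \<open>\<phi>\<close> is extended to the extended positive part as the supremum of
  the normal positive functionals that it dominates.\<close>

definition dual_weight :: "('h::hilbert_space, 'k::hilbert_space) haagerup_data \<Rightarrow>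
    ('h op \<Rightarrow> ennreal) \<Rightarrow> 'k op \<Rightarrow> ennreal" where
  "dual_weight D \<phi> x =
     (SUP \<xi> \<in> {\<xi>. square_summable \<xi> \<and>
                  (\<forall>m\<in>pos_part (vna D). vector_functional \<xi> (pi_rep D m) \<le> \<phi> m)}.
        \<integral>\<^sup>+ s. vector_functional \<xi> (theta_bdd D s x) \<partial>lborel)"

text \<open>The weight \<open>\<tau>(k \<cdot>)\<close>, i.e. the limit of \<open>\<tau>(k\<^sub>\<epsilon>\<^sup>1\<^sup>/\<^sup>2 x k\<^sub>\<epsilon>\<^sup>1\<^sup>/\<^sup>2)\<close> with
  \<open>k\<^sub>\<epsilon> = k(1 + \<epsilon>k)\<^sup>-\<^sup>1\<close> as \<open>\<epsilon>\<close> decreases to zero; the family is increasing.\<close>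

definition trace_density :: "('h::hilbert_space, 'k::hilbert_space) haagerup_data \<Rightarrow>
    'k graph \<Rightarrow> 'k op \<Rightarrow> ennreal" where
  "trace_density D k x = (SUP \<epsilon>\<in>{0::real<..}.
     let r = fun_of (fcalc (\<lambda>t. sqrt (t / (1 + \<epsilon> * t))) k) in trc D (r \<circ> x \<circ> r))"

text \<open>The density of the dual weight \<open>\<nu>\<^sup>~\<close> with respect to the trace.\<close>

definition dual_weight_density :: "('h::hilbert_space, 'k::hilbert_space) haagerup_data \<Rightarrow> bool" where
  "dual_weight_density D \<longleftrightarrow>
     positive_selfadjoint (dens D) \<and> nonsingular (dens D) \<and>
     affiliated (crossed_product D) (dens D) \<and>
     (\<forall>x\<in>pos_part (crossed_product D). dual_weight D (wt D) x = trace_density D (dens D) x)"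

text \<open>The last clause, \<open>h\<^sup>i\<^sup>t = \<lambda>(t)\<close>, is the normalisation
  \<open>(D\<nu>\<^sup>~ : D\<tau>)\<^sub>t = \<lambda>(t)\<close> that singles out the canonical trace.\<close>

definition canonical_trace :: "('h::hilbert_space, 'k::hilbert_space) haagerup_data \<Rightarrow> bool" where
  "canonical_trace D \<longleftrightarrow>
     fns_weight (crossed_product D) (trc D) \<and>
     (\<forall>x\<in>crossed_product D. trc D (cadj x \<circ> x) = trc D (x \<circ> cadj x)) \<and>
     (\<forall>s. \<forall>x\<in>pos_part (crossed_product D). trc D (theta_bdd D s x) = ennreal (exp (- s)) * trc D x) \<and>
     (\<forall>t. fcalcC (\<lambda>u. cis (t * ln u)) (dens D) = graph_of (lambda_rep D t))"


section \<open>Measurable operators and Haagerup spaces\<close>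

definition measurable_ops :: "('h::hilbert_space, 'k::hilbert_space) haagerup_data \<Rightarrow> 'k graph set" where
  "measurable_ops D = {a. closed_operator a \<and> densely_defined a \<and> affiliated (crossed_product D) a \<and>
     (\<forall>\<delta>>0. \<exists>p\<in>projections (crossed_product D).
        range p \<subseteq> Domain a \<and> trc D (compl_proj p) \<le> ennreal \<delta>)}"

definition measure_nbhd ::
  "('h::hilbert_space, 'k::hilbert_space) haagerup_data \<Rightarrow> real \<Rightarrow> real \<Rightarrow> 'k graph set" where
  "measure_nbhd D \<epsilon> \<delta> = {a\<in>measurable_ops D. \<exists>p\<in>projections (crossed_product D).
     range p \<subseteq> Domain a \<and> (\<forall>(x, y)\<in>a. x \<in> range p \<longrightarrow> norm y \<le> \<epsilon> * norm x) \<and>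
     trc D (compl_proj p) \<le> ennreal \<delta>}"

definition closure_in_measure ::
  "('h::hilbert_space, 'k::hilbert_space) haagerup_data \<Rightarrow> 'k graph set \<Rightarrow> 'k graph set" where
  "closure_in_measure D S = {x\<in>measurable_ops D.
     \<forall>\<epsilon>>0. \<forall>\<delta>>0. \<exists>y\<in>S. x \<oplus> sscale (- 1) y \<in> measure_nbhd D \<epsilon> \<delta>}"

definition Lp :: "('h::hilbert_space, 'k::hilbert_space) haagerup_data \<Rightarrow> real \<Rightarrow> 'k graph set" where
  "Lp D p = {x\<in>measurable_ops D. \<forall>s. theta D s x = sscale (complex_of_real (exp (- s / p))) x}"

definition Linf :: "('h::hilbert_space, 'k::hilbert_space) haagerup_data \<Rightarrow> 'k graph set" where
  "Linf D = {x\<in>measurable_ops D. \<forall>s. theta D s x = x}"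

text \<open>Haagerup's trace functional: a positive \<open>k \<in> L\<^sup>1\<close> is the density \<open>d\<phi>\<^sup>~/d\<tau>\<close> of the dual
  weight of a unique normal positive functional \<open>\<phi>\<close>, and \<open>tr k = \<phi>(1)\<close>.
  The norm is \<open>tr(|x|\<^sup>p)\<^sup>1\<^sup>/\<^sup>p\<close>.\<close>

definition haagerup_tr ::
  "('h::hilbert_space, 'k::hilbert_space) haagerup_data \<Rightarrow> 'k graph \<Rightarrow> ennreal" where
  "haagerup_tr D k = (THE c. \<exists>\<phi>. weight (vna D) \<phi> \<and> normal_weight (vna D) \<phi> \<and> \<phi> id < \<infinity> \<and>
     (\<forall>x\<in>pos_part (crossed_product D). dual_weight D \<phi> x = trace_density D k x) \<and> c = \<phi> id)"

definition norm_p ::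
  "('h::hilbert_space, 'k::hilbert_space) haagerup_data \<Rightarrow> real \<Rightarrow> 'k graph \<Rightarrow> real" where
  "norm_p D p x = enn2real (haagerup_tr D (fcalc (\<lambda>t. t powr p) (gabs x))) powr (1 / p)"

definition norm_inf :: "'k::hilbert_space graph \<Rightarrow> real" where
  "norm_inf x = enn2real (SUP (\<xi>, \<eta>)\<in>{(\<xi>, \<eta>)\<in>x. norm \<xi> \<le> 1}. ennreal (norm \<eta>))"

definition L2l :: "('h::hilbert_space, 'k::hilbert_space) haagerup_data \<Rightarrow> 'k graph set" where
  "L2l D = closure_in_measure D
     {graph_of (pi_rep D a) \<odot> fcalc sqrt (dens D) |a. a \<in> n_ideal (vna D) (wt D)}"

definition L2r :: "('h::hilbert_space, 'k::hilbert_space) haagerup_data \<Rightarrow> 'k graph set" where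
  "L2r D = closure_in_measure D
     {fcalc sqrt (dens D) \<odot> graph_of (pi_rep D (cadj a)) |a. a \<in> n_ideal (vna D) (wt D)}"


section \<open>The space X and the K-functional\<close>

definition phi_cap :: "real \<Rightarrow> real" where "phi_cap t = max 1 t"
definition phi_sum :: "real \<Rightarrow> real" where "phi_sum t = min 1 t"
definition zeta1 :: "real \<Rightarrow> real" where "zeta1 t = phi_sum t / t"

definition phi_half :: "('h::hilbert_space, 'k::hilbert_space) haagerup_data \<Rightarrow> 'k graph" where
  "phi_half D = fcalc (\<lambda>t. sqrt (phi_sum t)) (dens D)"

definition zeta_half :: "('h::hilbert_space, 'k::hilbert_space) haagerup_data \<Rightarrow> 'k graph" where
  "zeta_half D = fcalc (\<lambda>t. sqrt (zeta1 t)) (dens D)"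

definition iota_inf where "iota_inf D a = phi_half D \<odot> a \<odot> phi_half D"
definition iota_2r where "iota_2r D a = zeta_half D \<odot> a \<odot> phi_half D"
definition iota_2l where "iota_2l D a = phi_half D \<odot> a \<odot> zeta_half D"
definition iota_1 where "iota_1 D a = zeta_half D \<odot> a \<odot> zeta_half D"

text \<open>\<open>phi_cap(h)\<^sup>1\<^sup>/\<^sup>2\<close> itself need not be measurable, but its cut-offs are bounded.\<close>

definition phi_cap_cut ::
  "('h::hilbert_space, 'k::hilbert_space) haagerup_data \<Rightarrow> real \<Rightarrow> 'k graph" where
  "phi_cap_cut D \<delta> = fcalc (\<lambda>t. sqrt (phi_cap t) * indicator {0..\<delta>} t) (dens D)"

definition S_sum :: "('h::hilbert_space, 'k::hilbert_space) haagerup_data \<Rightarrow> 'k graph set" where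
  "S_sum D = {a\<in>measurable_ops D. \<forall>\<delta>>0. \<forall>s.
     theta D s (a \<odot> phi_cap_cut D \<delta>) =
       sscale (complex_of_real (exp (- s / 2))) (a \<odot> phi_cap_cut D (exp s * \<delta>))}"

definition X_sum :: "('h::hilbert_space, 'k::hilbert_space) haagerup_data \<Rightarrow> 'k graph set" where
  "X_sum D = strong_span {gadj a \<odot> b |a b. a \<in> S_sum D \<and> b \<in> S_sum D}"

definition representations :: "('h::hilbert_space, 'k::hilbert_space) haagerup_data \<Rightarrow> 'k graph \<Rightarrow>
    ('k graph \<times> 'k graph \<times> 'k graph \<times> 'k graph) set" where
  "representations D f = {(f1, f2r, f2l, fi).
     f1 \<in> Lp D 1 \<and> f2r \<in> L2r D \<and> f2l \<in> L2l D \<and> fi \<in> Linf D \<and>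
     f = iota_1 D f1 \<oplus> iota_2r D f2r \<oplus> iota_2l D f2l \<oplus> iota_inf D fi}"

text \<open>The infimum of non-negative numbers is formed in \<^typ>\<open>ennreal\<close>. It is finite whenever
  \<open>f\<close> has a representation; since \<open>X_sum D\<close> is the sum of the ranges of the four
  maps \<open>\<iota>\<close>, this is the case for all \<open>f \<in> X_sum D\<close>.\<close>

definition Ktilde ::
  "('h::hilbert_space, 'k::hilbert_space) haagerup_data \<Rightarrow> 'k graph \<Rightarrow> real \<Rightarrow> real" where
  "Ktilde D f t = enn2real (INF (f1, f2r, f2l, fi)\<in>representations D f.
     ennreal (norm_p D 1 f1 + sqrt t * norm_p D 2 f2r + sqrt t * norm_p D 2 f2l + t * norm_inf fi))"

definition K_density :: "(real \<Rightarrow> real) \<Rightarrow> real \<Rightarrow> (real \<Rightarrow> real) \<Rightarrow> bool" where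
  "K_density K K0 k \<longleftrightarrow>
     (\<forall>s>0. 0 \<le> k s) \<and> (\<forall>r s. 0 < r \<and> r \<le> s \<longrightarrow> k s \<le> k r) \<and>
     (\<forall>s>0. continuous (at_right s) k) \<and>
     (\<forall>t>0. set_integrable lborel {0<..<t} k \<and> K t = K0 + (LBINT s:{0<..<t}. k s))"

end

theory Submission
  imports Defs
begin

text \<open>Each representation of \<open>f\<close> contributes a function
  \<open>c\<^sub>0 + c\<^sub>1 \<surd>t + c\<^sub>2 t\<close> with non-negative coefficients, so the
  infimum over all of them is increasing and concave. The density of an increasing concave function
  is its right derivative, which is the supremum of the slopes to the right. On \<open>[s, t]\<close>
  the increments of the function and of the integral of this density both lie between the same
  bounds \<open>(t - s) k(t)\<close> and \<open>(t - s) k(s)\<close>; subdividing makes the gap vanish.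
  The same bounds, together with right-continuity, give uniqueness.\<close>

section \<open>Increasing concave functions as integrals\<close>

lemma concave_on_slope_le:
  fixes F :: "real \<Rightarrow> real"
  assumes "concave_on I F" "x \<in> I" "z \<in> I" "x < y" "y < z"
  shows "(F z - F y) / (z - y) \<le> (F y - F x) / (y - x)"
proof -
  have "(- F x - - F y) / (x - y) \<le> (- F y - - F z) / (y - z)"
    using convex_on_slope_le[of I "\<lambda>x. - F x" x z y] assms by (fastforce simp: concave_on_def)
  moreover have "(- F x - - F y) / (x - y) = - ((F y - F x) / (y - x))"
    using assms(4) by (simp add: field_simps)
  moreover have "(- F y - - F z) / (y - z) = - ((F z - F y) / (z - y))"
    using assms(5) by (simp add: field_simps)
  ultimately show ?thesis by linarith
qed

definition right_slope :: "(real \<Rightarrow> real) \<Rightarrow> real \<Rightarrow> real" where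
  "right_slope F s = (SUP t\<in>{s<..}. (F t - F s) / (t - s))"

lemma right_slope_le:
  assumes "concave_on {0..} F" "0 < s" "s < t"
  shows "right_slope F t \<le> (F t - F s) / (t - s)"
  unfolding right_slope_def
  using concave_on_slope_le[OF assms(1), of s _ t] assms by (intro cSUP_least) auto

lemma le_right_slope:
  assumes "concave_on {0..} F" "0 < s" "s < t"
  shows "(F t - F s) / (t - s) \<le> right_slope F s"
  unfolding right_slope_def
proof (rule cSUP_upper)
  \<comment> \<open>The chord from 0 to \<open>s\<close> is at least as steep as every chord to the
    right of \<open>s\<close>. This needs \<open>0 < s\<close>: like \<open>sqrt\<close>,
    \<open>F\<close> may have unbounded slopes at 0.\<close>
  show "bdd_above ((\<lambda>t. (F t - F s) / (t - s)) ` {s<..})"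
    using concave_on_slope_le[OF assms(1), of 0 _ s] assms
    by (intro bdd_aboveI2[where M = "(F s - F 0) / (s - 0)"]) auto
qed (use assms in auto)

lemma concave_on_imp_isCont:
  fixes F :: "real \<Rightarrow> real"
  assumes "concave_on {0..} F" "0 < s"
  shows "isCont F s"
proof -
  have "convex_on {0<..} (\<lambda>x. - F x)"
    using assms(1) unfolding concave_on_def by (rule convex_on_subset) auto
  then have "continuous_on {0<..} (\<lambda>x. - F x)"
    by (rule convex_on_continuous[rotated]) auto
  then have "continuous_on {0<..} (\<lambda>x. - (- F x))"
    by (rule continuous_on_minus)
  then show ?thesis
    using assms(2) by (simp add: continuous_on_eq_continuous_at)
qed

text \<open>For \<open>s < t\<close> the slope of the chord over \<open>[s, t]\<close> separates the
  two values.\<close>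

lemma right_slope_antimono:
  assumes "concave_on {0..} F" "0 < s" "s \<le> t"
  shows "right_slope F t \<le> right_slope F s"
  using right_slope_le[OF assms(1), of s t] le_right_slope[OF assms(1), of s t] assms by force

lemma right_slope_nonneg:
  assumes "concave_on {0..} F" "mono_on {0..} F" "0 < s"
  shows "0 \<le> right_slope F s"
proof -
  have "F s \<le> F (s + 1)"
    using assms by (intro mono_onD[OF assms(2)]) auto
  then show ?thesis
    using le_right_slope[OF assms(1), of s "s + 1"] assms(3) by simp
qed

text \<open>Each quotient with a fixed far end \<open>t\<close> is continuous in the base point, so
  the supremum is lower semicontinuous. Being decreasing gives the upper half, but only from the
  right.\<close>

lemma right_slope_right_continuous:
  assumes "concave_on {0..} F" "0 < s"
  shows "continuous (at_right s) (right_slope F)"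
  unfolding continuous_within
proof (rule order_tendstoI)
  fix c assume "c < right_slope F s"
  then obtain t where t: "s < t" "c < (F t - F s) / (t - s)"
    unfolding right_slope_def
    using less_cSUP_iff[of "{s<..}" "\<lambda>t. (F t - F s) / (t - s)" c]
    by (metis (no_types, lifting) cSUP_least greaterThan_iff greaterThan_non_empty not_le)
  have "((\<lambda>u. (F t - F u) / (t - u)) \<longlongrightarrow> (F t - F s) / (t - s)) (at_right s)"
    using t concave_on_imp_isCont[OF assms]
    by (intro tendsto_intros) (auto simp: isCont_def intro: tendsto_mono[OF at_le])
  then have "\<forall>\<^sub>F u in at_right s. c < (F t - F u) / (t - u)"
    using t(2) by (rule order_tendstoD)
  moreover have "\<forall>\<^sub>F u in at_right s. u \<in> {s<..<t}"
    using t(1) by (rule eventually_at_right_real)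
  ultimately show "\<forall>\<^sub>F u in at_right s. c < right_slope F u"
  proof eventually_elim
    case (elim u)
    then show ?case
      using le_right_slope[OF assms(1), of u t] assms(2) by simp
  qed
next
  fix c assume c: "right_slope F s < c"
  have "\<forall>\<^sub>F u in at_right s. u \<in> {s<..<s + 1}"
    by (rule eventually_at_right_real) simp
  then show "\<forall>\<^sub>F u in at_right s. right_slope F u < c"
  proof eventually_elim
    case (elim u)
    then show ?case
      using right_slope_antimono[OF assms(1), of s u] assms(2) c by simp
  qed
qed

section \<open>Integral and subdivision bounds for decreasing functions\<close>

lemma set_borel_measurable_antimono:
  fixes k :: "real \<Rightarrow> real"
  assumes "A \<in> sets borel" "antimono_on A k"
  shows "set_borel_measurable lborel A k"
proof -
  have "mono_on A (\<lambda>x. - k x)"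
    using assms(2) by (auto simp: monotone_on_def)
  then have "(\<lambda>x. - k x) \<in> borel_measurable (restrict_space borel A)"
    by (rule borel_measurable_mono_on_fnc)
  then have "k \<in> borel_measurable (restrict_space borel A)"
    using borel_measurable_uminus by fastforce
  then show ?thesis
    unfolding set_borel_measurable_def using assms(1)
    by (subst (asm) borel_measurable_restrict_space_iff) (auto simp: mult.commute)
qed

lemma set_integrable_antimono:
  fixes k :: "real \<Rightarrow> real"
  assumes "antimono_on {a..b} k"
  shows "set_integrable lborel {a..b} k"
proof (rule set_integrable_bound[where f = "\<lambda>_. max \<bar>k a\<bar> \<bar>k b\<bar>"])
  show "set_borel_measurable lborel {a..b} k"
    using assms by (rule set_borel_measurable_antimono[rotated]) simp
  show "AE x in lborel. x \<in> {a..b} \<longrightarrow> norm (k x) \<le> norm (max \<bar>k a\<bar> \<bar>k b\<bar>)"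
  proof (intro AE_I2 impI)
    fix x assume "x \<in> {a..b}"
    then have "k x \<le> k a" "k b \<le> k x"
      using assms by (auto simp: monotone_on_def)
    then show "norm (k x) \<le> norm (max \<bar>k a\<bar> \<bar>k b\<bar>)" by auto
  qed
qed (auto simp: set_integrable_def emeasure_lborel_Icc_eq intro!: integrable_real_indicator)

lemma set_integral_antimono_bounds:
  fixes k :: "real \<Rightarrow> real"
  assumes "antimono_on {a..b} k" "a \<le> b"
  shows "(b - a) * k b \<le> (LBINT x:{a..b}. k x)" "(LBINT x:{a..b}. k x) \<le> (b - a) * k a"
proof -
  have const: "set_integrable lborel {a..b} (\<lambda>_. c)" "(LBINT x:{a..b}. c) = (b - a) * c" for c :: real
    using assms(2) by (auto simp: set_integrable_def set_lebesgue_integral_def)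
  have "(LBINT x:{a..b}. k b) \<le> (LBINT x:{a..b}. k x)" "(LBINT x:{a..b}. k x) \<le> (LBINT x:{a..b}. k a)"
    using assms by (auto intro!: set_integral_mono const set_integrable_antimono simp: monotone_on_def)
  then show "(b - a) * k b \<le> (LBINT x:{a..b}. k x)" "(LBINT x:{a..b}. k x) \<le> (b - a) * k a"
    by (simp_all only: const)
qed

text \<open>Over \<open>n\<close> equal pieces of \<open>[a, b]\<close> the bounds telescope to
  \<open>(b - a) / n * (k a - k b)\<close>.\<close>

lemma increments_le_antimono_imp_eq:
  fixes G k :: "real \<Rightarrow> real"
  assumes incr: "\<And>s t. \<lbrakk>a \<le> s; s \<le> t; t \<le> b\<rbrakk> \<Longrightarrow> \<bar>G t - G s\<bar> \<le> (t - s) * (k s - k t)"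
    and ab: "a \<le> b"
  shows "G a = G b"
proof -
  have bound: "\<bar>G b - G a\<bar> \<le> (b - a) * (k a - k b) * inverse (real (Suc n))" for n
  proof -
    define d where "d = (b - a) / Suc n"
    have d: "0 \<le> d" "Suc n * d = b - a" using ab by (auto simp: d_def)
    have "\<bar>G (a + i * d) - G a\<bar> \<le> d * (k a - k (a + i * d))" if "i \<le> Suc n" for i :: nat
      using that
    proof (induction i)
      case (Suc i)
      have "real (Suc i) * d \<le> Suc n * d"
        using d Suc.prems by (intro mult_right_mono) auto
      then have "\<bar>G (a + Suc i * d) - G (a + i * d)\<bar>
          \<le> (a + Suc i * d - (a + i * d)) * (k (a + i * d) - k (a + Suc i * d))"
        using d by (intro incr) (auto simp: algebra_simps)
      also have "a + Suc i * d - (a + i * d) = d"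
        by (simp add: algebra_simps)
      finally show ?case
        using Suc by (simp add: algebra_simps)
    qed simp
    from this[of "Suc n"] have "\<bar>G b - G a\<bar> \<le> d * (k a - k b)"
      using d by simp
    then show ?thesis by (simp add: d_def divide_inverse mult_ac)
  qed
  \<comment> \<open>Only the bound depends on \<open>n\<close>, so its limit 0 bounds the fixed
    increment.\<close>
  have "(\<lambda>n. (b - a) * (k a - k b) * inverse (real (Suc n))) \<longlonglongrightarrow> (b - a) * (k a - k b) * 0"
    by (intro tendsto_intros LIMSEQ_inverse_real_of_nat)
  then have "\<bar>G b - G a\<bar> \<le> (b - a) * (k a - k b) * 0"
    by (rule LIMSEQ_le_const) (use bound in blast)
  then show ?thesis by simp
qed

section \<open>Recovering a concave function from its right derivative\<close>

lemma integral_right_slope: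
  assumes F: "concave_on {0..} F" and ab: "0 < a" "a \<le> b"
  shows "(LBINT s:{a..b}. right_slope F s) = F b - F a"
proof -
  let ?k = "right_slope F"
  have anti: "antimono_on {s..t} ?k" if "0 < s" for s t
    using right_slope_antimono[OF F] that by (auto simp: monotone_on_def)
  \<comment> \<open>Over \<open>[s, t]\<close> the increments of the integral and of
    \<open>F\<close> lie in one interval of length \<open>(t - s) * (?k s - ?k t)\<close>, which
    therefore bounds the increment of \<open>G\<close>.\<close>
  define G where "G t = (LBINT s:{a..t}. ?k s) - F t" for t
  have "\<bar>G t - G s\<bar> \<le> (t - s) * (?k s - ?k t)" if st: "a \<le> s" "s \<le> t" "t \<le> b" for s t
  proof (cases "s = t")
    case False
    with st have st': "s < t" by simp
    have eq: "{a..t} = {a..s} \<union> {s..t}"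
      using st by auto
    have "(LBINT x:{a..t}. ?k x) = (LBINT x:{a..s}. ?k x) + (LBINT x:{s..t}. ?k x)"
      unfolding eq
    proof (rule set_integral_Un_AE)
      \<comment> \<open>The two closed pieces overlap in the null set \<open>{s}\<close>.\<close>
      show "AE x in lborel. \<not> (x \<in> {a..s} \<and> x \<in> {s..t})"
        using AE_lborel_singleton[of s] by eventually_elim auto
    qed (use ab st in \<open>auto intro!: set_integrable_antimono anti\<close>)
    moreover have "(t - s) * ?k t \<le> F t - F s" "F t - F s \<le> (t - s) * ?k s"
      using right_slope_le[OF F _ st'] le_right_slope[OF F _ st'] ab st st'
      by (simp_all add: field_simps)
    moreover have "(t - s) * ?k t \<le> (LBINT x:{s..t}. ?k x)" "(LBINT x:{s..t}. ?k x) \<le> (t - s) * ?k s"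
      using set_integral_antimono_bounds[OF anti] ab st by auto
    ultimately show ?thesis
      unfolding G_def abs_le_iff right_diff_distrib by linarith
  qed simp
  then have "G a = G b"
    using ab(2) by (rule increments_le_antimono_imp_eq)
  moreover have "(LBINT s:{a..a}. ?k s) = 0"
    using set_integral_antimono_bounds[of a a ?k] by (simp add: monotone_on_def)
  ultimately show ?thesis
    by (simp add: G_def)
qed

text \<open>The limit need not be \<open>F 0\<close>: an increasing concave function on the closed
  half-line may jump upwards at 0. The value \<open>F 0\<close> serves only as a lower
  bound.\<close>

lemma mono_on_tendsto_at_right_0:
  fixes F :: "real \<Rightarrow> real"
  assumes "mono_on {0..} F"
  shows "(F \<longlongrightarrow> (INF t\<in>{0<..}. F t)) (at_right 0)"
proof (rule order_tendstoI)
  have bdd: "bdd_below (F ` {0<..})"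
    using assms by (intro bdd_belowI2[where m = "F 0"]) (auto simp: monotone_on_def)
  {
    fix c assume "c < (INF t\<in>{0<..}. F t)"
    then have "c < F t" if "0 < t" for t
      using cINF_lower[OF bdd, of t] that by simp
    then show "\<forall>\<^sub>F t in at_right 0. c < F t"
      by (auto simp: eventually_at_filter)
  next
    fix c assume "(INF t\<in>{0<..}. F t) < c"
    then obtain t where t: "0 < t" "F t < c"
      using cINF_less_iff[OF _ bdd] by auto
    have "\<forall>\<^sub>F u in at_right 0. u \<in> {0<..<t}"
      using t(1) by (rule eventually_at_right_real)
    then show "\<forall>\<^sub>F u in at_right 0. F u < c"
    proof eventually_elim
      case (elim u)
      then show ?case
        using mono_onD[OF assms, of u t] t by simp
    qed
  }
qed

text \<open>The slope may be unbounded near 0, so the open interval from 0 to \<open>t\<close> is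
  exhausted by compact intervals \<open>[l i, u i]\<close>. As the slope is non-negative,
  convergence of their integrals gives both integrability and the value.\<close>

lemma K_density_right_slope:
  assumes F: "concave_on {0..} F" and mono: "mono_on {0..} F"
    and lim: "(F \<longlongrightarrow> K0) (at_right 0)"
  shows "K_density F K0 (right_slope F)"
proof -
  let ?k = "right_slope F"
  have main: "set_integrable lborel {0<..<t} ?k \<and> F t = K0 + (LBINT s:{0<..<t}. ?k s)" if t: "0 < t" for t
  proof -
    have "ereal 0 < ereal t" using t by simp
    then obtain u l :: "nat \<Rightarrow> real" where approx:
      "einterval (ereal 0) (ereal t) = (\<Union>i. {l i .. u i})" "incseq u" "decseq l" "\<And>i. l i < u i"
      "\<And>i. ereal 0 < l i" "\<And>i. u i < ereal t" "l \<longlonglongrightarrow> ereal 0" "u \<longlonglongrightarrow> ereal t"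
      by (rule einterval_Icc_approximation) blast
    have l: "0 < l i" for i using approx(5)[of i] by simp
    have integrable: "set_integrable lborel {l i..u i} ?k" for i
      using right_slope_antimono[OF F] l[of i]
      by (intro set_integrable_antimono) (force simp: monotone_on_def)
    have nonneg: "AE x in lborel. ereal 0 < ereal x \<longrightarrow> ereal x < ereal t \<longrightarrow> 0 \<le> ?k x"
      using right_slope_nonneg[OF F mono] by auto
    have meas: "set_borel_measurable lborel (einterval (ereal 0) (ereal t)) ?k"
      using right_slope_antimono[OF F]
      by (intro set_borel_measurable_antimono) (auto simp: monotone_on_def einterval_def)
    have "(LBINT x=l i..u i. ?k x) = F (u i) - F (l i)" for i
      using integral_right_slope[OF F l, of i "u i"] approx(4)[of i]
      by (simp add: interval_integral_Icc less_imp_le)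
    moreover have "(\<lambda>i. F (u i)) \<longlonglongrightarrow> F t"
      using isCont_tendsto_compose[OF concave_on_imp_isCont[OF F t]] approx(8) by simp
    \<comment> \<open>The points \<open>l i\<close> are positive, so they approach 0 from the right,
      where \<open>F\<close> has limit \<open>K0\<close>.\<close>
    moreover have "(\<lambda>i. F (l i)) \<longlonglongrightarrow> K0"
      using l approx(7) less_imp_neq[OF l]
      by (intro filterlim_compose[OF lim]) (auto simp: filterlim_at intro!: always_eventually)
    ultimately have conv: "(\<lambda>i. LBINT x=l i..u i. ?k x) \<longlonglongrightarrow> F t - K0"
      by (simp add: tendsto_diff)
    note interval_integral_Icc_approx_nonneg[OF \<open>ereal 0 < ereal t\<close> approx integrable nonneg meas conv]
    moreover have "einterval 0 (ereal t) = {0<..<t}"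
      by (auto simp: einterval_def)
    ultimately show ?thesis
      using t by (simp add: interval_lebesgue_integral_def zero_ereal_def[symmetric])
  qed
  show ?thesis
    unfolding K_density_def
    using main right_slope_nonneg[OF F mono] right_slope_antimono[OF F] right_slope_right_continuous[OF F]
    by blast
qed

section \<open>Uniqueness of the density\<close>

lemma K_density_increment:
  assumes "K_density F K0 k" "0 < s" "s < t"
  shows "(t - s) * k t \<le> F t - F s" "F t - F s \<le> (t - s) * k s"
proof -
  have anti: "antimono_on {s..t} k"
    using assms unfolding K_density_def monotone_on_def by auto
  have int: "set_integrable lborel {0<..<u} k" "F u = K0 + (LBINT x:{0<..<u}. k x)" if "0 < u" for u
    using assms(1) that by (auto simp: K_density_def)
  have "(LBINT x:{0<..<t}. k x) = (LBINT x:{0<..<s}. k x) + (LBINT x:{s..<t}. k x)"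
  proof -
    have eq: "{0<..<t} = {0<..<s} \<union> {s..<t}"
      using assms by auto
    show ?thesis
      unfolding eq using assms
      by (intro set_integral_Un) (auto intro!: set_integrable_subset[OF int(1)[of t]])
  qed
  \<comment> \<open>The bounds for decreasing functions concern closed intervals; the added end
    point has integral 0.\<close>
  also have "(LBINT x:{s..<t}. k x) = (LBINT x:{s..t}. k x)"
  proof -
    have eq: "{s..t} = {s..<t} \<union> {t..t}"
      using assms by auto
    have "(LBINT x:{s..t}. k x) = (LBINT x:{s..<t}. k x) + (LBINT x:{t..t}. k x)"
      unfolding eq using assms
      by (intro set_integral_Un set_integrable_subset[OF set_integrable_antimono[OF anti]]) auto
    moreover have "(LBINT x:{t..t}. k x) = 0"
      using set_integral_antimono_bounds[of t t k] by (simp add: monotone_on_def)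
    ultimately show ?thesis by simp
  qed
  finally have "F t - F s = (LBINT x:{s..t}. k x)"
    using int(2)[of s] int(2)[of t] assms by simp
  then show "(t - s) * k t \<le> F t - F s" "F t - F s \<le> (t - s) * k s"
    using set_integral_antimono_bounds[OF anti] assms by auto
qed

text \<open>For \<open>t > s\<close> the mean slope of \<open>F\<close> over \<open>[s, t]\<close>
  is at least \<open>k' t\<close> and at most \<open>k s\<close>; now let \<open>t\<close> decrease
  to \<open>s\<close>. Exchanging the two densities yields equality.\<close>

lemma K_density_le:
  assumes k: "K_density F K0 k" and k': "K_density F K0 k'" and s: "0 < s"
  shows "k' s \<le> k s"
proof (rule tendsto_upperbound)
  show "(k' \<longlongrightarrow> k' s) (at_right s)"
    using k' s by (auto simp: K_density_def continuous_within)
  have "k' t \<le> k s" if "s < t" for t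
  proof -
    have "(t - s) * k' t \<le> (t - s) * k s"
      using K_density_increment(1)[OF k' s that] K_density_increment(2)[OF k s that] by linarith
    then show ?thesis using that by simp
  qed
  then show "\<forall>\<^sub>F t in at_right s. k' t \<le> k s"
    by (auto simp: eventually_at_filter)
qed simp

lemma K_density_unique:
  assumes "K_density F K0 k" "K_density F K0 k'" "0 < s"
  shows "k' s = k s"
  using K_density_le[OF assms] K_density_le[OF assms(2,1,3)] by simp


section \<open>The K-functional\<close>

lemma enn2real_INF_ennreal:
  assumes "I \<noteq> {}" "\<And>i. i \<in> I \<Longrightarrow> 0 \<le> g i"
  shows "enn2real (INF i\<in>I. ennreal (g i)) = (INF i\<in>I. g i)"
proof (rule antisym)
  show "enn2real (INF i\<in>I. ennreal (g i)) \<le> (INF i\<in>I. g i)"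
    using assms by (intro cINF_greatest enn2real_leI) (auto intro: INF_lower)
  have bdd: "bdd_below (g ` I)"
    using assms by (intro bdd_belowI2[where m = 0]) auto
  obtain i where i: "i \<in> I" using assms(1) by blast
  \<comment> \<open>Monotonicity of \<open>enn2real\<close> requires a finite upper value, because
    \<open>enn2real\<close> sends \<open>top\<close> to 0.\<close>
  have "(INF i\<in>I. ennreal (g i)) < top"
    using INF_lower[OF i, of "\<lambda>i. ennreal (g i)"] by (simp add: le_less_trans)
  moreover have "ennreal (INF i\<in>I. g i) \<le> (INF i\<in>I. ennreal (g i))"
    by (intro INF_greatest ennreal_leI cINF_lower bdd)
  ultimately have "enn2real (ennreal (INF i\<in>I. g i)) \<le> enn2real (INF i\<in>I. ennreal (g i))"
    by (rule enn2real_mono[rotated])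
  moreover have "0 \<le> (INF i\<in>I. g i)"
    using assms by (intro cINF_greatest) auto
  ultimately show "(INF i\<in>I. g i) \<le> enn2real (INF i\<in>I. ennreal (g i))"
    by simp
qed

lemma concave_on_INF:
  fixes g :: "'i \<Rightarrow> 'a::real_vector \<Rightarrow> real"
  assumes "I \<noteq> {}" "\<And>i. i \<in> I \<Longrightarrow> concave_on C (g i)"
    and bdd: "\<And>x. x \<in> C \<Longrightarrow> bdd_below ((\<lambda>i. g i x) ` I)"
  shows "concave_on C (\<lambda>x. INF i\<in>I. g i x)"
  unfolding concave_on_iff
proof (intro conjI ballI allI impI)
  show "convex C" using assms concave_on_imp_convex by blast
  fix x y and u v :: real assume uv: "x \<in> C" "y \<in> C" "0 \<le> u" "0 \<le> v" "u + v = 1"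
  show "u * (INF i\<in>I. g i x) + v * (INF i\<in>I. g i y) \<le> (INF i\<in>I. g i (u *\<^sub>R x + v *\<^sub>R y))"
  proof (rule cINF_greatest[OF assms(1)])
    fix i assume i: "i \<in> I"
    have "u * (INF i\<in>I. g i x) + v * (INF i\<in>I. g i y) \<le> u * g i x + v * g i y"
      using uv i by (intro add_mono mult_left_mono cINF_lower bdd)
    also have "\<dots> \<le> g i (u *\<^sub>R x + v *\<^sub>R y)"
      using assms(2)[OF i] uv by (simp add: concave_on_iff)
    finally show "u * (INF i\<in>I. g i x) + v * (INF i\<in>I. g i y) \<le> g i (u *\<^sub>R x + v *\<^sub>R y)" .
  qed
qed

lemma concave_on_sqrt: "concave_on {0..} sqrt"
proof (rule concave_on_linorderI)
  fix t x y :: real assume t: "0 < t" "t < 1" and xy: "x \<in> {0..}" "y \<in> {0..}" "x < y"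
  \<comment> \<open>After squaring, the gap in the concavity inequality is an explicit non-negative
    term.\<close>
  have "((1 - t) * sqrt x + t * sqrt y)\<^sup>2 = (1 - t) * x + t * y - t * (1 - t) * (sqrt y - sqrt x)\<^sup>2"
    using xy by (simp add: power2_eq_square algebra_simps)
  also have "\<dots> \<le> (1 - t) * x + t * y"
    using t by simp
  finally show "(1 - t) * sqrt x + t * sqrt y \<le> sqrt ((1 - t) *\<^sub>R x + t *\<^sub>R y)"
    by (simp add: real_le_rsqrt)
qed simp

section \<open>Monotonicity and concavity of the K-functional\<close>

text \<open>Isolates the dependence on \<open>t\<close> for one representation, so that monotonicity
  and concavity can be checked there and passed to the infimum.\<close>

definition K_cost :: "('h::hilbert_space, 'k::hilbert_space) haagerup_data \<Rightarrow>
    'k graph \<times> 'k graph \<times> 'k graph \<times> 'k graph \<Rightarrow> real \<Rightarrow> real" where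
  "K_cost D = (\<lambda>(f1, f2r, f2l, fi) t.
     norm_p D 1 f1 + sqrt t * norm_p D 2 f2r + sqrt t * norm_p D 2 f2l + t * norm_inf fi)"

lemma norm_p_nonneg: "0 \<le> norm_p D p x"
  by (simp add: norm_p_def)

lemma norm_inf_nonneg: "0 \<le> norm_inf x"
  by (simp add: norm_inf_def)

lemma K_cost_nonneg: "0 \<le> t \<Longrightarrow> 0 \<le> K_cost D r t"
  by (simp add: K_cost_def norm_p_nonneg norm_inf_nonneg split: prod.split)

lemma K_cost_mono: "s \<le> t \<Longrightarrow> K_cost D r s \<le> K_cost D r t"
  by (auto simp: K_cost_def norm_p_nonneg norm_inf_nonneg split: prod.split
      intro!: add_mono mult_right_mono)

lemma concave_on_K_cost: "concave_on {0..} (K_cost D r)"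
proof (cases r)
  case (fields f1 f2r f2l fi)
  \<comment> \<open>The norms stand in front as non-negative factors of \<open>sqrt t\<close> and
    \<open>t\<close>.\<close>
  have "concave_on {0..} (\<lambda>t. norm_p D 1 f1 + norm_p D 2 f2r * sqrt t + norm_p D 2 f2l * sqrt t
      + norm_inf fi * t)"
    by (intro concave_on_add concave_on_cmul concave_on_sqrt norm_p_nonneg norm_inf_nonneg)
      (simp_all add: concave_on_const concave_on_ident)
  then show ?thesis
    by (simp add: fields K_cost_def mult.commute)
qed

lemma Ktilde_eq_INF:
  assumes "representations D f \<noteq> {}" "0 \<le> t"
  shows "Ktilde D f t = (INF r\<in>representations D f. K_cost D r t)"
proof -
  have "Ktilde D f t = enn2real (INF r\<in>representations D f. ennreal (K_cost D r t))"
    by (simp add: Ktilde_def K_cost_def case_prod_beta)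
  then show ?thesis
    using assms by (simp add: enn2real_INF_ennreal K_cost_nonneg)
qed

text \<open>Without representations the infimum is \<open>\<infinity>\<close>, which \<^const>\<open>enn2real\<close> sends to \<open>0\<close>.\<close>

lemma Ktilde_eq_0:
  assumes "representations D f = {}"
  shows "Ktilde D f t = 0"
  using assms by (simp add: Ktilde_def)

lemma bdd_below_K_cost: "0 \<le> t \<Longrightarrow> bdd_below ((\<lambda>r. K_cost D r t) ` R)"
  by (intro bdd_belowI2[where m = 0] K_cost_nonneg)

lemma mono_on_Ktilde: "mono_on {0..} (Ktilde D f)"
proof (cases "representations D f = {}")
  case False
  show ?thesis
  proof (rule mono_onI)
    fix s t :: real assume "s \<in> {0..}" "t \<in> {0..}" "s \<le> t"
    then show "Ktilde D f s \<le> Ktilde D f t"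
      using False by (auto simp: Ktilde_eq_INF intro!: cINF_mono bdd_below_K_cost K_cost_mono)
  qed
qed (simp add: Ktilde_eq_0 monotone_on_def)

lemma concave_on_Ktilde: "concave_on {0..} (Ktilde D f)"
proof (cases "representations D f = {}")
  case False
  have "concave_on {0..} (\<lambda>t. INF r\<in>representations D f. K_cost D r t)"
    using False by (intro concave_on_INF concave_on_K_cost bdd_below_K_cost) auto
  then show ?thesis
    using False by (simp add: concave_on_iff Ktilde_eq_INF)
qed (simp add: concave_on_iff Ktilde_eq_0)

theorem proposition4p16:
  fixes D :: "('h::hilbert_space, 'k::hilbert_space) haagerup_data"
    and f :: "'k graph"
  assumes "von_neumann_algebra (vna D)"
    and "fns_weight (vna D) (wt D)"
    and "modular_group (vna D) (wt D) (modgrp D)"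
    and "L2_completion (emb D)"
    and "canonical_trace D"
    and "dual_weight_density D"
    and "f \<in> X_sum D"
  shows "(\<forall>t\<ge>0. 0 \<le> Ktilde D f t) \<and>
    mono_on {0..} (Ktilde D f) \<and>
    concave_on {0..} (Ktilde D f) \<and>
    (\<exists>K0. (Ktilde D f \<longlongrightarrow> K0) (at_right 0) \<and>
       (\<exists>k. K_density (Ktilde D f) K0 k \<and>
            (\<forall>k'. K_density (Ktilde D f) K0 k' \<longrightarrow> (\<forall>s>0. k' s = k s))))"
proof -
  let ?K = "Ktilde D f"
  have lim: "(?K \<longlongrightarrow> (INF t\<in>{0<..}. ?K t)) (at_right 0)"
    by (rule mono_on_tendsto_at_right_0[OF mono_on_Ktilde])
  \<comment> \<open>The witnesses are the infimum over \<open>t > 0\<close> for the value at 0+ and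
    the right derivative for the density.\<close>
  have "K_density ?K (INF t\<in>{0<..}. ?K t) (right_slope ?K)"
    by (rule K_density_right_slope[OF concave_on_Ktilde mono_on_Ktilde lim])
  moreover have "0 \<le> ?K t" for t
    by (simp add: Ktilde_def)
  ultimately show ?thesis
    using lim mono_on_Ktilde concave_on_Ktilde K_density_unique by blast
qed

end
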